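(* Let $G$ be a finite nonabelian nilpotent group of nilpotence class $c$. Then $Z_{c-1}\le V(G)$.
   Context: For a finite group $G$, $\mathrm{nl}(G)$ is the set of irreducible complex characters of $G$ of degree greater than $1$. For a nonabelian finite group $G$, $V(G)=\langle g\in G \mid \text{there exists } \chi\in\mathrm{nl}(G) \text{ such that } \chi(g)\neq 0\rangle$. The upper central series of $G$ is $Z_1=\mathbf{Z}(G)$ (the center) and $Z_i/Z_{i-1}=\mathbf{Z}(G/Z_{i-1})$ for $i>1$. *)

theory Defs
  imports
    "HOL-Algebra.Coset"
    "HOL-Algebra.Generated_Groups"
    "Jordan_Normal_Form.Matrix"
    "Jordan_Normal_Form.VS_Connect"
begin

section \<open>Complex characters\<close>

definition GL :: "nat \<Rightarrow> complex mat monoid" where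
  "GL n = units_of (ring_mat TYPE(complex) n ())"

definition mat_trace :: "complex mat \<Rightarrow> complex" where
  "mat_trace A = (\<Sum>i<dim_row A. A $$ (i, i))"

definition invariant_subspace ::
  "('a, 'b) monoid_scheme \<Rightarrow> nat \<Rightarrow> ('a \<Rightarrow> complex mat) \<Rightarrow> complex vec set \<Rightarrow> bool" where
  "invariant_subspace G n \<rho> W \<longleftrightarrow>
     VectorSpace.subspace class_ring W (module_vec TYPE(complex) n) \<and>
     (\<forall>g\<in>carrier G. \<forall>w\<in>W. \<rho> g *\<^sub>v w \<in> W)"

definition irreducible_representation ::
  "('a, 'b) monoid_scheme \<Rightarrow> nat \<Rightarrow> ('a \<Rightarrow> complex mat) \<Rightarrow> bool" where
  "irreducible_representation G n \<rho> \<longleftrightarrow>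
     \<rho> \<in> hom G (GL n) \<and> n > 0 \<and>
     (\<forall>W. invariant_subspace G n \<rho> W \<longrightarrow> W = {0\<^sub>v n} \<or> W = carrier_vec n)"

text \<open>Characters are restricted to the carrier, so that two of them are equal as HOL
  functions iff they agree on the group.\<close>

definition Irr :: "('a, 'b) monoid_scheme \<Rightarrow> ('a \<Rightarrow> complex) set" where
  "Irr G = {\<lambda>g\<in>carrier G. mat_trace (\<rho> g) | n \<rho>. irreducible_representation G n \<rho>}"

text \<open>The degree of a character \<open>\<chi>\<close> is \<open>\<chi>(1)\<close>, a positive integer.\<close>

definition nl :: "('a, 'b) monoid_scheme \<Rightarrow> ('a \<Rightarrow> complex) set" where
  "nl G = {\<chi> \<in> Irr G. \<exists>d::nat. \<chi> \<one>\<^bsub>G\<^esub> = of_nat d \<and> d > 1}"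

definition vanishing_off :: "('a, 'b) monoid_scheme \<Rightarrow> 'a set" where
  "vanishing_off G = generate G {g \<in> carrier G. \<exists>\<chi>\<in>nl G. \<chi> g \<noteq> 0}"


section \<open>Upper central series and nilpotence\<close>

definition center :: "('a, 'b) monoid_scheme \<Rightarrow> 'a set" where
  "center G = {z \<in> carrier G. \<forall>x\<in>carrier G. z \<otimes>\<^bsub>G\<^esub> x = x \<otimes>\<^bsub>G\<^esub> z}"

text \<open>The successor step takes the preimage in \<open>G\<close> of the center of \<open>G / Z\<^sub>i\<close>. The series is
  started at \<open>Z\<^sub>0 = 1\<close>; \<open>upper_central_1\<close> below gives \<open>Z\<^sub>1 = Z(G)\<close>.\<close>

primrec upper_central :: "('a, 'b) monoid_scheme \<Rightarrow> nat \<Rightarrow> 'a set" where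
  "upper_central G 0 = {\<one>\<^bsub>G\<^esub>}"
| "upper_central G (Suc i) =
     {x \<in> carrier G. upper_central G i #>\<^bsub>G\<^esub> x \<in> center (G Mod upper_central G i)}"

definition nilpotent_group :: "('a, 'b) monoid_scheme \<Rightarrow> bool" where
  "nilpotent_group G \<longleftrightarrow> group G \<and> (\<exists>n. upper_central G n = carrier G)"

definition nilpotence_class :: "('a, 'b) monoid_scheme \<Rightarrow> nat" where
  "nilpotence_class G = (LEAST n. upper_central G n = carrier G)"

lemma (in group) center_normal: "center G \<lhd> G"
proof -
  have sub: "subgroup (center G) G"
  proof (rule subgroupI)
    show "center G \<subseteq> carrier G" "center G \<noteq> {}"
      by (auto simp: center_def intro!: exI[of _ \<one>])
  next
    fix a assume a: "a \<in> center G"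
    show "inv a \<in> center G"
      unfolding center_def
    proof (intro CollectI conjI ballI)
      show ia: "inv a \<in> carrier G" using a by (simp add: center_def)
      fix x assume x: "x \<in> carrier G"
      have ac: "a \<in> carrier G" and eq: "a \<otimes> inv x = inv x \<otimes> a"
        using a x by (simp_all add: center_def)
      have "inv a \<otimes> x = inv (inv x \<otimes> a)" using ac x by (simp add: inv_mult_group)
      also have "\<dots> = inv (a \<otimes> inv x)" by (simp only: eq)
      also have "\<dots> = x \<otimes> inv a" using ac x by (simp add: inv_mult_group)
      finally show "inv a \<otimes> x = x \<otimes> inv a" .
    qed
  next
    fix a b assume "a \<in> center G" "b \<in> center G"
    then have "a \<in> carrier G" "b \<in> carrier G"
      "\<And>x. x \<in> carrier G \<Longrightarrow> a \<otimes> x = x \<otimes> a" "\<And>x. x \<in> carrier G \<Longrightarrow> b \<otimes> x = x \<otimes> b"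
      by (auto simp: center_def)
    note ab = this
    have "a \<otimes> b \<otimes> x = x \<otimes> (a \<otimes> b)" if x: "x \<in> carrier G" for x
    proof -
      have "a \<otimes> b \<otimes> x = a \<otimes> (x \<otimes> b)" using ab(1,2) x by (simp only: m_assoc ab(4)[OF x])
      also have "\<dots> = (x \<otimes> a) \<otimes> b" using ab(1,2) x by (simp only: m_assoc[symmetric] ab(3)[OF x])
      finally show ?thesis using ab(1,2) x by (simp only: m_assoc)
    qed
    with ab(1,2) show "a \<otimes> b \<in> center G"
      unfolding center_def by blast
  qed
  show ?thesis
  proof (rule normal_invI[OF sub])
    fix x h assume x: "x \<in> carrier G" and h: "h \<in> center G"
    then have "h \<in> carrier G" "x \<otimes> h = h \<otimes> x" by (simp_all add: center_def)
    with x have "x \<otimes> h \<otimes> inv x = h" by (simp add: m_assoc)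
    with h show "x \<otimes> h \<otimes> inv x \<in> center G" by simp
  qed
qed

lemma (in group_hom) normal_vimage:
  assumes "N \<lhd> H"
  shows "{x \<in> carrier G. h x \<in> N} \<lhd> G"
proof -
  have sub: "subgroup N H" using assms by (rule normal_imp_subgroup)
  have sub': "subgroup {x \<in> carrier G. h x \<in> N} G"
    by (rule G.subgroupI)
      (auto simp: subgroup.m_inv_closed[OF sub] subgroup.m_closed[OF sub] subgroup.one_closed[OF sub]
        intro!: exI[of _ "\<one>"])
  show ?thesis
  proof (rule G.normal_invI[OF sub'])
    fix x y assume "x \<in> carrier G" and "y \<in> {x \<in> carrier G. h x \<in> N}"
    then have xy: "x \<in> carrier G" "y \<in> carrier G" "h y \<in> N" by simp_all
    have "h x \<otimes>\<^bsub>H\<^esub> h y \<otimes>\<^bsub>H\<^esub> inv\<^bsub>H\<^esub> h x \<in> N"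
      using xy by (intro normal.inv_op_closed2[OF assms]) simp_all
    with xy show "x \<otimes> y \<otimes> inv x \<in> {x \<in> carrier G. h x \<in> N}" by simp
  qed
qed

lemma (in group) upper_central_normal: "upper_central G i \<lhd> G"
proof (induction i)
  case 0
  show ?case by (simp add: one_is_normal)
next
  case (Suc i)
  have quot: "group (G Mod upper_central G i)"
    using Suc by (rule normal.factorgroup_is_group)
  have "group_hom G (G Mod upper_central G i) (\<lambda>x. upper_central G i #> x)"
    by (intro group_hom.intro group_hom_axioms.intro is_group quot normal.r_coset_hom_Mod Suc)
  from group_hom.normal_vimage[OF this group.center_normal[OF quot]]
  show ?case by (simp only: upper_central.simps)
qed

lemma (in group) upper_central_1: "upper_central G 1 = center G"
proof -
  have cos: "{\<one>} #> x = {x}" if "x \<in> carrier G" for x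
    using that by (auto simp: r_coset_def)
  have carr: "carrier (G Mod {\<one>}) = (\<lambda>x. {x}) ` carrier G"
    by (auto simp: FactGroup_def RCOSETS_def cos)
  have mult: "{x} \<otimes>\<^bsub>G Mod {\<one>}\<^esub> {y} = {x \<otimes> y}" for x y
    by (simp add: FactGroup_def set_mult_def)
  have *: "{x} \<in> center (G Mod {\<one>}) \<longleftrightarrow> x \<in> center G" if "x \<in> carrier G" for x
    using that by (simp add: center_def carr mult del: mult_FactGroup)
  show ?thesis
  proof (rule Set.set_eqI)
    fix x
    have "x \<in> upper_central G 1 \<longleftrightarrow> x \<in> carrier G \<and> {x} \<in> center (G Mod {\<one>})"
      by (auto simp: cos simp del: mult_FactGroup)
    also have "\<dots> \<longleftrightarrow> x \<in> center G"
      using * by (auto simp: center_def simp del: mult_FactGroup)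
    finally show "x \<in> upper_central G 1 \<longleftrightarrow> x \<in> center G" .
  qed
qed

end

theory Submission
  imports Defs "Jordan_Normal_Form.Spectral_Radius" "HOL-Algebra.Multiplicative_Group"
begin

text \<open>Let \<open>N = Z\<^sub>c\<^sub>-\<^sub>2\<close> and \<open>H = G / N\<close>, a group of class 2, in which the elements of \<open>Z\<^sub>c\<^sub>-\<^sub>1\<close> become
  central. By Schur's lemma a central element acts as a nonzero scalar in an irreducible
  representation, so no irreducible character of \<open>H\<close> vanishes on it, and it suffices that \<open>H\<close> has
  an irreducible representation of degree greater than 1. Take a commutator \<open>z \<noteq> 1\<close> in \<open>H\<close>, which is
  central. The regular representation has an eigenvector of \<open>z\<close> with eigenvalue \<open>\<mu> \<noteq> 1\<close>; the
  eigenspace is invariant, and an invariant subspace of minimal dimension in it is irreducible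
  with \<open>z\<close> acting as \<open>\<mu>\<close>. In degree 1 the commutator \<open>z\<close> would act trivially.\<close>

section \<open>Linear algebra: subspaces as images of injective matrices\<close>

lemma module_vec_subspace_iff:
  fixes W :: "'a :: field vec set"
  shows "VectorSpace.subspace class_ring W (module_vec TYPE('a) n) \<longleftrightarrow>
    W \<subseteq> carrier_vec n \<and> 0\<^sub>v n \<in> W \<and> (\<forall>v\<in>W. \<forall>w\<in>W. v + w \<in> W) \<and> (\<forall>c. \<forall>v\<in>W. c \<cdot>\<^sub>v v \<in> W)"
proof -
  interpret vec_space "TYPE('a)" n .
  have "vectorspace class_ring (module_vec TYPE('a) n)" "Module.module class_ring (module_vec TYPE('a) n)"
    by unfold_locales
  then show ?thesis
    unfolding VectorSpace.subspace_def submodule_def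
    by (auto simp: module_vec_simps class_ring_simps)
qed

text \<open>Applied to \<open>unit_vec n j\<close>, a matrix returns its column \<open>j\<close>, so
  the action on vectors determines every entry.\<close>

lemma mat_eqI_mult_vec:
  fixes A B :: "'a :: semiring_1 mat"
  assumes A: "A \<in> carrier_mat m n" and B: "B \<in> carrier_mat m n"
    and eq: "\<And>v. v \<in> carrier_vec n \<Longrightarrow> A *\<^sub>v v = B *\<^sub>v v"
  shows "A = B"
proof (rule eq_matI)
  fix i j assume ij: "i < dim_row B" "j < dim_col B"
  have *: "(C *\<^sub>v unit_vec n j) $ i = C $$ (i, j)" if "C \<in> carrier_mat m n" for C :: "'a mat"
    using that ij B by simp
  show "A $$ (i, j) = B $$ (i, j)"
    using *[OF A] *[OF B] eq[of "unit_vec n j"] by simp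
qed (use A B in auto)

text \<open>If \<open>n < d\<close>, padding \<open>P\<close> with zero rows gives a singular square
  matrix, and a nonzero kernel vector of it is also killed by \<open>P\<close>.\<close>

lemma injective_mat_dim_le:
  fixes P :: "'a :: field mat"
  assumes P: "P \<in> carrier_mat n d"
    and inj: "\<And>u. u \<in> carrier_vec d \<Longrightarrow> P *\<^sub>v u = 0\<^sub>v n \<Longrightarrow> u = 0\<^sub>v d"
  shows "d \<le> n"
proof (rule ccontr)
  assume "\<not> d \<le> n"
  then have nd: "n < d" by simp
  define B where "B = mat d d (\<lambda>(i, j). if i < n then P $$ (i, j) else 0)"
  have B: "B \<in> carrier_mat d d" by (simp add: B_def)
  \<comment> \<open>Row \<open>n\<close> of \<open>B\<close> is the first padded row, hence zero; it
    is column \<open>n\<close> of the transpose, so the transpose is singular.\<close>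
  have "transpose_mat B *\<^sub>v unit_vec d n = 0\<^sub>v d"
    using nd by (intro eq_vecI) (auto simp: B_def)
  moreover have "unit_vec d n \<noteq> (0\<^sub>v d :: 'a vec)"
    using nd by simp
  ultimately have "det (transpose_mat B) = 0"
    using B by (subst det_0_iff_vec_prod_zero[of _ d]) (auto intro!: exI[of _ "unit_vec d n"])
  then have "det B = 0" using det_transpose[OF B] by simp
  then obtain u where u: "u \<in> carrier_vec d" "u \<noteq> 0\<^sub>v d" "B *\<^sub>v u = 0\<^sub>v d"
    using det_0_iff_vec_prod_zero[OF B] by auto
  have "P *\<^sub>v u = 0\<^sub>v n"
  proof (rule eq_vecI)
    fix i assume "i < dim_vec (0\<^sub>v n :: 'a vec)"
    then have i: "i < n" by simp
    have "(P *\<^sub>v u) $ i = (B *\<^sub>v u) $ i"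
      using i nd P u(1) by (auto simp: B_def scalar_prod_def)
    then show "(P *\<^sub>v u) $ i = 0\<^sub>v n $ i" using u i nd by simp
  qed (use P in simp)
  with inj u show False by blast
qed

lemma injective_square_mat_surj:
  fixes P :: "'a :: field mat"
  assumes P: "P \<in> carrier_mat n n"
    and inj: "\<And>u. u \<in> carrier_vec n \<Longrightarrow> P *\<^sub>v u = 0\<^sub>v n \<Longrightarrow> u = 0\<^sub>v n"
    and w: "w \<in> carrier_vec n"
  obtains u where "u \<in> carrier_vec n" "w = P *\<^sub>v u"
proof -
  have "det P \<noteq> 0" using det_0_iff_vec_prod_zero[OF P] inj by blast
  from det_non_zero_imp_unit[OF P this, of "()"]
  obtain Q where Q: "Q \<in> carrier_mat n n" "P * Q = 1\<^sub>m n"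
    by (auto simp: Units_def ring_mat_simps)
  have "w = P *\<^sub>v (Q *\<^sub>v w)"
    using P Q w by (simp flip: assoc_mult_mat_vec)
  then show ?thesis using that[of "Q *\<^sub>v w"] Q w by auto
qed

text \<open>The columns of \<open>P\<close> are a basis of \<open>W\<close>: trivial kernel is
  linear independence, and the image is the span. A matrix of this kind with the most columns must
  span, since a vector of \<open>W\<close> outside its image could be appended as a further
  column.\<close>

lemma subspace_basis_mat:
  fixes W :: "'a :: field vec set"
  assumes W: "VectorSpace.subspace class_ring W (module_vec TYPE('a) n)" and W0: "W \<noteq> {0\<^sub>v n}"
  obtains d P where "P \<in> carrier_mat n d" "0 < d" "d \<le> n" "W \<noteq> carrier_vec n \<Longrightarrow> d < n"
    "\<And>u. u \<in> carrier_vec d \<Longrightarrow> P *\<^sub>v u = 0\<^sub>v n \<Longrightarrow> u = 0\<^sub>v d"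
    "W = (\<lambda>u. P *\<^sub>v u) ` carrier_vec d"
proof -
  note W = W[unfolded module_vec_subspace_iff]
  define basis_like where "basis_like d P \<longleftrightarrow> P \<in> carrier_mat n d \<and>
    (\<forall>u \<in> carrier_vec d. P *\<^sub>v u = 0\<^sub>v n \<longrightarrow> u = 0\<^sub>v d) \<and> (\<lambda>u. P *\<^sub>v u) ` carrier_vec d \<subseteq> W" for d and P :: "'a mat"
  have le: "d \<le> n" if "basis_like d P" for d P
    using that injective_mat_dim_le[of P n d] unfolding basis_like_def by blast
  \<comment> \<open>The empty family of columns shows that the maximum is taken over a nonempty set;
    \<open>le\<close> bounds it.\<close>
  have "basis_like 0 (mat n 0 (\<lambda>_. 0))"
  proof -
    have "mat n 0 (\<lambda>_. 0) *\<^sub>v u = 0\<^sub>v n" if "u \<in> carrier_vec 0" for u :: "'a vec"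
      using that by (intro eq_vecI) (auto simp: scalar_prod_def)
    then show ?thesis using W by (auto simp: basis_like_def)
  qed
  then have "\<exists>d. (\<exists>P. basis_like d P) \<and> (\<forall>d'. (\<exists>P. basis_like d' P) \<longrightarrow> d' \<le> d)"
    using le by (intro ex_has_greatest_nat[of _ 0 _ "Suc n"]) (auto simp: less_Suc_eq_le)
  then obtain d P where P: "basis_like d P" and max: "\<And>d' P'. basis_like d' P' \<Longrightarrow> d' \<le> d"
    by blast
  have Pc: "P \<in> carrier_mat n d" using P by (simp add: basis_like_def)
  have inj: "u = 0\<^sub>v d" if "u \<in> carrier_vec d" "P *\<^sub>v u = 0\<^sub>v n" for u
    using P that by (auto simp: basis_like_def)
  have sub: "(\<lambda>u. P *\<^sub>v u) ` carrier_vec d \<subseteq> W" using P by (simp add: basis_like_def)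
  have "w \<in> (\<lambda>u. P *\<^sub>v u) ` carrier_vec d" if wW: "w \<in> W" for w
  proof (rule ccontr)
    assume nin: "w \<notin> (\<lambda>u. P *\<^sub>v u) ` carrier_vec d"
    have w: "w \<in> carrier_vec n" using wW W by auto
    \<comment> \<open>\<open>P'\<close> is \<open>P\<close> with \<open>w\<close> appended as last
      column; \<open>r u\<close> drops the last coordinate of \<open>u\<close>, which is the
      coefficient of \<open>w\<close>.\<close>
    define P' where "P' = mat n (Suc d) (\<lambda>(i, j). if j < d then P $$ (i, j) else w $ i)"
    define r where "r u = vec d (\<lambda>j. u $ j)" for u :: "'a vec"
    have r: "r u \<in> carrier_vec d" for u by (simp add: r_def)
    have P'u: "P' *\<^sub>v u = P *\<^sub>v r u + u $ d \<cdot>\<^sub>v w" if u: "u \<in> carrier_vec (Suc d)" for u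
      using u w Pc by (intro eq_vecI) (auto simp: P'_def r_def scalar_prod_def)
    have "basis_like (Suc d) P'"
      unfolding basis_like_def
    proof (intro conjI ballI impI)
      show "P' \<in> carrier_mat n (Suc d)" by (simp add: P'_def)
      show "(\<lambda>u. P' *\<^sub>v u) ` carrier_vec (Suc d) \<subseteq> W"
      proof (intro image_subsetI)
        fix u :: "'a vec" assume u: "u \<in> carrier_vec (Suc d)"
        have "P *\<^sub>v r u \<in> W" "u $ d \<cdot>\<^sub>v w \<in> W" using W wW sub r by blast+
        with W show "P' *\<^sub>v u \<in> W" unfolding P'u[OF u] by blast
      qed
      fix u assume u: "u \<in> carrier_vec (Suc d)" and "P' *\<^sub>v u = 0\<^sub>v n"
      then have eq: "P *\<^sub>v r u + u $ d \<cdot>\<^sub>v w = 0\<^sub>v n" by (simp add: P'u)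
      \<comment> \<open>Otherwise the relation \<open>eq\<close> can be solved for \<open>w\<close>,
        which puts \<open>w\<close> into the image of \<open>P\<close>.\<close>
      have ud: "u $ d = 0"
      proof (rule ccontr)
        assume nz: "u $ d \<noteq> 0"
        have "w = P *\<^sub>v (- inverse (u $ d) \<cdot>\<^sub>v r u)"
        proof (rule eq_vecI)
          fix i assume "i < dim_vec (P *\<^sub>v (- inverse (u $ d) \<cdot>\<^sub>v r u))"
          then have i: "i < n" using Pc by simp
          have "(P *\<^sub>v r u + u $ d \<cdot>\<^sub>v w) $ i = 0" using eq i by simp
          then have "(P *\<^sub>v r u) $ i = - (u $ d * w $ i)"
            using i w Pc by (simp add: add_eq_0_iff2)
          then show "w $ i = (P *\<^sub>v (- inverse (u $ d) \<cdot>\<^sub>v r u)) $ i"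
            using nz i Pc by (simp add: mult_mat_vec[OF Pc r])
        qed (use w Pc in auto)
        moreover have "- inverse (u $ d) \<cdot>\<^sub>v r u \<in> carrier_vec d" using r by simp
        ultimately show False using nin by (meson image_eqI)
      qed
      have "0 \<cdot>\<^sub>v w = 0\<^sub>v n" using w by (intro eq_vecI) auto
      then have "P *\<^sub>v r u = 0\<^sub>v n" using eq ud mult_mat_vec_carrier[OF Pc r] by simp
      then have r0: "r u = 0\<^sub>v d" using inj r by blast
      show "u = 0\<^sub>v (Suc d)"
      proof (rule eq_vecI)
        fix j assume "j < dim_vec (0\<^sub>v (Suc d) :: 'a vec)"
        then consider "j < d" | "j = d" by fastforce
        then show "u $ j = 0\<^sub>v (Suc d) $ j"
        proof cases
          case 1
          then have "u $ j = r u $ j" by (simp add: r_def)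
          with r0 1 show ?thesis by simp
        qed (use ud in simp)
      qed (use u in simp)
    qed
    from max[OF this] show False by simp
  qed
  with sub have im: "W = (\<lambda>u. P *\<^sub>v u) ` carrier_vec d" by blast
  have "d \<noteq> 0"
  proof
    assume "d = 0"
    then have "P *\<^sub>v u = 0\<^sub>v n" if "u \<in> carrier_vec d" for u
      using that Pc by (intro eq_vecI) (auto simp: scalar_prod_def)
    with im W have "W = {0\<^sub>v n}" by auto
    with W0 show False ..
  qed
  \<comment> \<open>With \<open>d = n\<close> the injective square matrix \<open>P\<close> would be
    surjective, so \<open>W\<close> would be the whole space.\<close>
  moreover have "d < n" if "W \<noteq> carrier_vec n"
  proof (rule ccontr)
    assume "\<not> d < n"
    with le[OF P] have dn: "d = n" by simp
    have "w \<in> W" if w: "w \<in> carrier_vec n" for w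
    proof -
      obtain u where "u \<in> carrier_vec n" "w = P *\<^sub>v u"
        using injective_square_mat_surj[OF Pc[unfolded dn] inj[unfolded dn] w] .
      then show ?thesis using im dn by (metis image_eqI)
    qed
    with W that show False by blast
  qed
  ultimately show ?thesis
    by (intro that[OF Pc _ le[OF P] _ inj im]) simp_all
qed

section \<open>Matrix representations and their restriction to invariant subspaces\<close>

text \<open>A homomorphism into \<open>GL n\<close> described without units, so that new
  representations can be built without exhibiting inverse matrices.\<close>

definition matrix_rep :: "('a, 'b) monoid_scheme \<Rightarrow> nat \<Rightarrow> ('a \<Rightarrow> complex mat) \<Rightarrow> bool" where
  "matrix_rep G n \<rho> \<longleftrightarrow> \<rho> \<in> carrier G \<rightarrow> carrier_mat n n \<and> \<rho> \<one>\<^bsub>G\<^esub> = 1\<^sub>m n \<and>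
     (\<forall>g\<in>carrier G. \<forall>h\<in>carrier G. \<rho> (g \<otimes>\<^bsub>G\<^esub> h) = \<rho> g * \<rho> h)"

lemma matrix_repD:
  assumes "matrix_rep G n \<rho>"
  shows "g \<in> carrier G \<Longrightarrow> \<rho> g \<in> carrier_mat n n" "\<rho> \<one>\<^bsub>G\<^esub> = 1\<^sub>m n"
    "g \<in> carrier G \<Longrightarrow> h \<in> carrier G \<Longrightarrow> \<rho> (g \<otimes>\<^bsub>G\<^esub> h) = \<rho> g * \<rho> h"
  using assms by (auto simp: matrix_rep_def)

text \<open>Invertibility of \<open>\<rho> g\<close> comes for free: \<open>\<rho> (inv g)\<close>
  is a two-sided inverse.\<close>

lemma (in group) hom_GL_iff: "\<rho> \<in> hom G (GL n) \<longleftrightarrow> matrix_rep G n \<rho>"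
proof -
  interpret R: ring "ring_mat TYPE(complex) n ()" by (rule ring_mat)
  have carr: "carrier (GL n) = Units (ring_mat TYPE(complex) n ())"
    and mult: "(\<otimes>\<^bsub>GL n\<^esub>) = (*)" and one: "\<one>\<^bsub>GL n\<^esub> = 1\<^sub>m n"
    by (simp_all add: GL_def units_of_carrier units_of_mult units_of_one ring_mat_simps)
  have grp: "group (GL n)" unfolding GL_def by (rule R.units_group)
  show ?thesis
  proof
    assume h: "\<rho> \<in> hom G (GL n)"
    then have "\<rho> \<one> = 1\<^sub>m n" using hom_one[OF h is_group grp] by (simp add: one)
    moreover have "\<rho> g \<in> carrier_mat n n" if "g \<in> carrier G" for g
      using hom_in_carrier[OF h that] R.Units_closed by (simp add: carr ring_mat_simps)
    ultimately show "matrix_rep G n \<rho>"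
      using h by (auto simp: matrix_rep_def hom_def mult)
  next
    assume r: "matrix_rep G n \<rho>"
    have "\<rho> g \<in> carrier (GL n)" if g: "g \<in> carrier G" for g
    proof -
      have "\<rho> g * \<rho> (inv g) = 1\<^sub>m n" "\<rho> (inv g) * \<rho> g = 1\<^sub>m n"
        using g matrix_repD(3)[OF r, of g "inv g"] matrix_repD(3)[OF r, of "inv g" g] matrix_repD(2)[OF r]
        by simp_all
      then show ?thesis
        using g matrix_repD(1)[OF r] inv_closed[OF g] unfolding carr Units_def ring_mat_simps by blast
    qed
    then show "\<rho> \<in> hom G (GL n)"
      using r by (auto simp: matrix_rep_def hom_def mult)
  qed
qed

text \<open>Since \<open>z\<close> is central, \<open>\<rho> z\<close> commutes with every
  \<open>\<rho> g\<close>, and commuting operators preserve each other's eigenspaces.\<close>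

lemma eigenspace_invariant:
  assumes \<rho>: "matrix_rep G n \<rho>" and z: "z \<in> center G"
  shows "invariant_subspace G n \<rho> {v \<in> carrier_vec n. \<rho> z *\<^sub>v v = \<mu> \<cdot>\<^sub>v v}"
proof -
  have zc: "z \<in> carrier G" using z by (simp add: center_def)
  note c = matrix_repD(1)[OF \<rho>]
  note zcarr = c[OF zc]
  have "\<rho> z *\<^sub>v (\<rho> g *\<^sub>v v) = \<mu> \<cdot>\<^sub>v (\<rho> g *\<^sub>v v)"
    if g: "g \<in> carrier G" and v: "v \<in> carrier_vec n" and eq: "\<rho> z *\<^sub>v v = \<mu> \<cdot>\<^sub>v v" for g v
  proof -
    have "\<rho> z * \<rho> g = \<rho> g * \<rho> z"
      using matrix_repD(3)[OF \<rho> zc g] matrix_repD(3)[OF \<rho> g zc] z g by (simp add: center_def)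
    then have "\<rho> z *\<^sub>v (\<rho> g *\<^sub>v v) = \<rho> g *\<^sub>v (\<rho> z *\<^sub>v v)"
      using c[OF g] zcarr v by (metis assoc_mult_mat_vec)
    then show ?thesis using eq mult_mat_vec[OF c[OF g] v] by simp
  qed
  moreover have "\<rho> z *\<^sub>v 0\<^sub>v n = \<mu> \<cdot>\<^sub>v 0\<^sub>v n"
    using zcarr by (intro eq_vecI) auto
  moreover have "\<rho> z *\<^sub>v (v + w) = \<mu> \<cdot>\<^sub>v (v + w)"
    if "v \<in> carrier_vec n" "w \<in> carrier_vec n" "\<rho> z *\<^sub>v v = \<mu> \<cdot>\<^sub>v v" "\<rho> z *\<^sub>v w = \<mu> \<cdot>\<^sub>v w" for v w
    using that zcarr by (simp add: mult_add_distrib_mat_vec smult_add_distrib_vec)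
  moreover have "\<rho> z *\<^sub>v (k \<cdot>\<^sub>v v) = \<mu> \<cdot>\<^sub>v (k \<cdot>\<^sub>v v)"
    if "v \<in> carrier_vec n" "\<rho> z *\<^sub>v v = \<mu> \<cdot>\<^sub>v v" for k v
    using that mult_mat_vec[OF zcarr, of v k] by (simp add: smult_smult_assoc mult.commute)
  ultimately show ?thesis
    unfolding invariant_subspace_def module_vec_subspace_iff
    using c by (auto intro!: mult_mat_vec_carrier)
qed

lemma eigenspace_full:
  fixes A :: "'a :: comm_ring_1 mat"
  assumes A: "A \<in> carrier_mat n n"
    and full: "{v \<in> carrier_vec n. A *\<^sub>v v = \<mu> \<cdot>\<^sub>v v} = carrier_vec n"
  shows "A = \<mu> \<cdot>\<^sub>m 1\<^sub>m n"
proof (rule mat_eqI_mult_vec)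
  fix v :: "'a vec" assume v: "v \<in> carrier_vec n"
  then have "A *\<^sub>v v = \<mu> \<cdot>\<^sub>v v" using full by blast
  also have "\<dots> = (\<mu> \<cdot>\<^sub>m 1\<^sub>m n) *\<^sub>v v"
    using v by (intro eq_vecI) (auto simp: smult_scalar_prod_distrib)
  finally show "A *\<^sub>v v = (\<mu> \<cdot>\<^sub>m 1\<^sub>m n) *\<^sub>v v" .
qed (use A in auto)

text \<open>\<open>\<sigma>\<close> is the action on \<open>W\<close> written in the basis formed by
  the columns of \<open>P\<close>, and \<open>P\<close> intertwines it with \<open>\<rho>\<close>.
  Because \<open>P\<close> is injective it can be cancelled on the left, so \<open>\<sigma>\<close>
  inherits multiplicativity from \<open>\<rho>\<close>.\<close>

lemma matrix_rep_restrict: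
  fixes G (structure)
  assumes \<rho>: "matrix_rep G n \<rho>" and "group G"
    and inv: "invariant_subspace G n \<rho> W" and W0: "W \<noteq> {0\<^sub>v n}"
  obtains d P \<sigma> where "0 < d" "d \<le> n" "W \<noteq> carrier_vec n \<Longrightarrow> d < n" "P \<in> carrier_mat n d"
    "\<And>u. u \<in> carrier_vec d \<Longrightarrow> P *\<^sub>v u \<in> W"
    "\<And>u. u \<in> carrier_vec d \<Longrightarrow> P *\<^sub>v u = 0\<^sub>v n \<Longrightarrow> u = 0\<^sub>v d"
    "matrix_rep G d \<sigma>" "\<And>g. g \<in> carrier G \<Longrightarrow> \<rho> g * P = P * \<sigma> g"
proof -
  interpret group G by fact
  from inv W0 subspace_basis_mat[of W n] obtain d P where
    P: "P \<in> carrier_mat n d" and d: "0 < d" "d \<le> n" "W \<noteq> carrier_vec n \<Longrightarrow> d < n"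
    and inj: "\<And>u. u \<in> carrier_vec d \<Longrightarrow> P *\<^sub>v u = 0\<^sub>v n \<Longrightarrow> u = 0\<^sub>v d"
    and W: "W = (\<lambda>u. P *\<^sub>v u) ` carrier_vec d"
    unfolding invariant_subspace_def by metis
  have inj': "u = v" if "u \<in> carrier_vec d" "v \<in> carrier_vec d" "P *\<^sub>v u = P *\<^sub>v v" for u v
  proof -
    have "P *\<^sub>v (u - v) = 0\<^sub>v n"
      using that P by (simp add: mult_minus_distrib_mat_vec)
    then have "u - v = 0\<^sub>v d" using inj[of "u - v"] that by simp
    then have "(u - v) $ i = 0" if "i < d" for i using that by simp
    then show "u = v" using that(1,2) by (intro eq_vecI) auto
  qed
  have uniq: "S = T" if S: "S \<in> carrier_mat d d" and T: "T \<in> carrier_mat d d" and eq: "P * S = P * T" for S T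
  proof (rule mat_eqI_mult_vec[OF S T])
    fix v :: "complex vec" assume v: "v \<in> carrier_vec d"
    have "P *\<^sub>v (S *\<^sub>v v) = P *\<^sub>v (T *\<^sub>v v)"
      using eq P S T v by (metis assoc_mult_mat_vec)
    then show "S *\<^sub>v v = T *\<^sub>v v" using inj' S T v by auto
  qed
  have ex: "\<exists>S. S \<in> carrier_mat d d \<and> \<rho> g * P = P * S" if g: "g \<in> carrier G" for g
  proof -
    note \<rho>g = matrix_repD(1)[OF \<rho> g]
    \<comment> \<open>Each basis vector \<open>col P j\<close> is moved by \<open>\<rho> g\<close>
      within \<open>W\<close>; its new coordinates \<open>u\<close> become column \<open>j\<close>
      of the matrix \<open>S\<close>.\<close>
    have "\<exists>u. u \<in> carrier_vec d \<and> \<rho> g *\<^sub>v col P j = P *\<^sub>v u" if j: "j < d" for j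
    proof -
      have "col P j = P *\<^sub>v unit_vec d j" using P j by (intro eq_vecI) auto
      then have "col P j \<in> W" using W j by auto
      then have "\<rho> g *\<^sub>v col P j \<in> W" using inv g by (auto simp: invariant_subspace_def)
      then show ?thesis using W by auto
    qed
    then obtain u where u: "\<And>j. j < d \<Longrightarrow> u j \<in> carrier_vec d"
      "\<And>j. j < d \<Longrightarrow> \<rho> g *\<^sub>v col P j = P *\<^sub>v u j" by metis
    define S where "S = mat d d (\<lambda>(i, j). u j $ i)"
    have S: "S \<in> carrier_mat d d" by (simp add: S_def)
    have colS: "col S j = u j" if "j < d" for j
      using u(1)[OF that] that by (intro eq_vecI) (auto simp: S_def)
    have "\<rho> g * P = P * S"
    proof (intro mat_col_eqI)
      fix j assume "j < dim_col (P * S)"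
      then have j: "j < d" using S by simp
      show "col (\<rho> g * P) j = col (P * S) j"
        unfolding col_mult2[OF \<rho>g P j] col_mult2[OF P S j] using colS[OF j] u(2)[OF j] by simp
    qed (use \<rho>g P S in auto)
    with S show ?thesis by blast
  qed
  \<comment> \<open>By \<open>uniq\<close> there is only one candidate for each \<open>g\<close>, so
    the choice loses nothing.\<close>
  define \<sigma> where "\<sigma> g = (SOME S. S \<in> carrier_mat d d \<and> \<rho> g * P = P * S)" for g
  have \<sigma>: "\<sigma> g \<in> carrier_mat d d" "\<rho> g * P = P * \<sigma> g" if "g \<in> carrier G" for g
    using someI_ex[OF ex[OF that]] by (simp_all add: \<sigma>_def)
  have "matrix_rep G d \<sigma>"
    unfolding matrix_rep_def
  proof (intro conjI ballI)
    show "\<sigma> \<in> carrier G \<rightarrow> carrier_mat d d" using \<sigma> by blast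
    have "P * \<sigma> \<one> = P * 1\<^sub>m d" using \<sigma>(2)[of \<one>] matrix_repD(2)[OF \<rho>] P by simp
    then show "\<sigma> \<one> = 1\<^sub>m d" using uniq \<sigma> by simp
    fix g h assume g: "g \<in> carrier G" and h: "h \<in> carrier G"
    note c = matrix_repD(1)[OF \<rho> g] matrix_repD(1)[OF \<rho> h] \<sigma>(1)[OF g] \<sigma>(1)[OF h]
    have "P * \<sigma> (g \<otimes> h) = \<rho> g * \<rho> h * P"
      using g h \<sigma>(2)[of "g \<otimes> h"] matrix_repD(3)[OF \<rho> g h] by simp
    also have "\<dots> = \<rho> g * P * \<sigma> h"
      using c P \<sigma>(2)[OF h] by (simp add: assoc_mult_mat[of _ n n _ n _ d] assoc_mult_mat[of _ n n _ d _ d])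
    also have "\<dots> = P * (\<sigma> g * \<sigma> h)"
      using c P \<sigma>(2)[OF g] by (simp add: assoc_mult_mat[of _ n d _ d _ d])
    finally show "\<sigma> (g \<otimes> h) = \<sigma> g * \<sigma> h"
      using uniq[OF \<sigma>(1)] g h c by simp
  qed
  then show ?thesis using that[OF d P _ inj _ \<sigma>(2)] W by blast
qed

text \<open>On vectors of \<open>W\<close> the operator \<open>\<rho> z\<close> is multiplication by
  \<open>\<mu>\<close>; the intertwining relation and the injectivity of \<open>P\<close> transfer
  this to \<open>\<sigma> z\<close>.\<close>

lemma matrix_rep_restrict_scalar:
  assumes \<rho>: "matrix_rep G n \<rho>" and "group G"
    and inv: "invariant_subspace G n \<rho> W" and W0: "W \<noteq> {0\<^sub>v n}"
    and z: "z \<in> carrier G" and W: "W \<subseteq> {v \<in> carrier_vec n. \<rho> z *\<^sub>v v = \<mu> \<cdot>\<^sub>v v}"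
  obtains d \<sigma> where "0 < d" "d \<le> n" "W \<noteq> carrier_vec n \<Longrightarrow> d < n" "matrix_rep G d \<sigma>"
    "\<sigma> z = \<mu> \<cdot>\<^sub>m 1\<^sub>m d"
proof -
  from matrix_rep_restrict[OF \<rho> \<open>group G\<close> inv W0] obtain d P \<sigma> where
    d: "0 < d" "d \<le> n" "W \<noteq> carrier_vec n \<Longrightarrow> d < n" and P: "P \<in> carrier_mat n d"
    and PW: "\<And>u. u \<in> carrier_vec d \<Longrightarrow> P *\<^sub>v u \<in> W"
    and inj: "\<And>u. u \<in> carrier_vec d \<Longrightarrow> P *\<^sub>v u = 0\<^sub>v n \<Longrightarrow> u = 0\<^sub>v d"
    and \<sigma>: "matrix_rep G d \<sigma>" and int: "\<And>g. g \<in> carrier G \<Longrightarrow> \<rho> g * P = P * \<sigma> g"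
    by metis
  note c = matrix_repD(1)[OF \<sigma> z] matrix_repD(1)[OF \<rho> z]
  have "\<sigma> z *\<^sub>v u = \<mu> \<cdot>\<^sub>v u" if u: "u \<in> carrier_vec d" for u
  proof -
    have "P *\<^sub>v (\<sigma> z *\<^sub>v u) = \<rho> z *\<^sub>v (P *\<^sub>v u)"
      using int[OF z] c P u by (metis assoc_mult_mat_vec)
    also have "\<dots> = \<mu> \<cdot>\<^sub>v (P *\<^sub>v u)" using PW[OF u] W by blast
    also have "\<dots> = P *\<^sub>v (\<mu> \<cdot>\<^sub>v u)" using mult_mat_vec[OF P u] by simp
    finally have "P *\<^sub>v (\<sigma> z *\<^sub>v u - \<mu> \<cdot>\<^sub>v u) = 0\<^sub>v n"
      using c P u by (simp add: mult_minus_distrib_mat_vec[of P n d])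
    then have "\<sigma> z *\<^sub>v u - \<mu> \<cdot>\<^sub>v u = 0\<^sub>v d" using inj[of "\<sigma> z *\<^sub>v u - \<mu> \<cdot>\<^sub>v u"] c u by simp
    then have "(\<sigma> z *\<^sub>v u - \<mu> \<cdot>\<^sub>v u) $ i = 0" if "i < d" for i using that by simp
    then show ?thesis using c u by (intro eq_vecI) auto
  qed
  then have "\<sigma> z = \<mu> \<cdot>\<^sub>m 1\<^sub>m d" using c by (intro eigenspace_full) auto
  with that d \<sigma> show ?thesis by blast
qed

text \<open>Strong induction on the degree: a reducible representation is restricted to a proper
  nonzero invariant subspace, which has smaller degree and on which \<open>z\<close> still acts as
  \<open>\<mu>\<close>.\<close>

lemma irreducible_with_scalar:
  assumes "group G" and z: "z \<in> carrier G"
    and "matrix_rep G n \<rho>" "0 < n" "\<rho> z = \<mu> \<cdot>\<^sub>m 1\<^sub>m n"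
  obtains d \<sigma> where "irreducible_representation G d \<sigma>" "\<sigma> z = \<mu> \<cdot>\<^sub>m 1\<^sub>m d"
proof -
  interpret group G by fact
  have "\<exists>d \<sigma>. irreducible_representation G d \<sigma> \<and> \<sigma> z = \<mu> \<cdot>\<^sub>m 1\<^sub>m d"
    using assms(3-)
  proof (induction n arbitrary: \<rho> rule: less_induct)
    case (less n)
    show ?case
    proof (cases "irreducible_representation G n \<rho>")
      case False
      then obtain W where W: "invariant_subspace G n \<rho> W" "W \<noteq> {0\<^sub>v n}" "W \<noteq> carrier_vec n"
        using less.prems by (auto simp: irreducible_representation_def hom_GL_iff)
      have "W \<subseteq> {v \<in> carrier_vec n. \<rho> z *\<^sub>v v = \<mu> \<cdot>\<^sub>v v}"
      proof
        fix w assume "w \<in> W"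
        then have w: "w \<in> carrier_vec n"
          using W(1) by (auto simp: invariant_subspace_def module_vec_subspace_iff)
        then have "(\<mu> \<cdot>\<^sub>m 1\<^sub>m n) *\<^sub>v w = \<mu> \<cdot>\<^sub>v w"
          by (intro eq_vecI) (auto simp: smult_scalar_prod_distrib)
        with w less.prems(3) show "w \<in> {v \<in> carrier_vec n. \<rho> z *\<^sub>v v = \<mu> \<cdot>\<^sub>v v}" by simp
      qed
      then obtain d \<sigma> where "0 < d" "d < n" "matrix_rep G d \<sigma>" "\<sigma> z = \<mu> \<cdot>\<^sub>m 1\<^sub>m d"
        using matrix_rep_restrict_scalar[OF less.prems(1) \<open>group G\<close> W(1,2) z, of \<mu>] W(3) by metis
      with less.IH show ?thesis by blast
    qed (use less.prems in blast)
  qed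
  with that show ?thesis by blast
qed

section \<open>An eigenvector in the regular representation\<close>

text \<open>Vectors of the left regular representation are functions on the group, and
  \<open>g\<close> acts by shifting the argument by \<open>inv g\<close>. An eigenvector of
  \<open>z\<close> is thus a nonzero function \<open>f\<close> with
  \<open>f (inv z \<otimes> g) = \<mu> * f g\<close>.\<close>

lemma (in group) regular_eigenvector:
  assumes fin: "finite (carrier G)" and z: "z \<in> carrier G" and z1: "z \<noteq> \<one>"
  obtains n \<rho> \<mu> v where "matrix_rep G n \<rho>" "\<mu> \<noteq> 1"
    "v \<in> carrier_vec n" "v \<noteq> 0\<^sub>v n" "\<rho> z *\<^sub>v v = \<mu> \<cdot>\<^sub>v v"
proof -
  define n where "n = card (carrier G)"
  from ex_bij_betw_nat_finite[OF fin] obtain e where e: "bij_betw e {0..<n} (carrier G)"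
    by (auto simp: n_def)
  define idx where "idx = the_inv_into {0..<n} e"
  have ec: "e i \<in> carrier G" if "i < n" for i using e that by (auto simp: bij_betw_def)
  have idx: "idx g < n" "e (idx g) = g" if "g \<in> carrier G" for g
    using e that the_inv_into_into[of e "{0..<n}" g "{0..<n}"] f_the_inv_into_f[of e "{0..<n}" g]
    by (auto simp: idx_def bij_betw_def)
  have e_iff: "g = e j \<longleftrightarrow> j = idx g" if "j < n" "g \<in> carrier G" for g j
    using e that idx[OF that(2)] the_inv_into_f_f[of e "{0..<n}" j] by (auto simp: idx_def bij_betw_def)
  \<comment> \<open>Left multiplication by \<open>g\<close> as a permutation matrix, with the group
    elements numbered by \<open>e\<close>.\<close>
  define \<rho> where "\<rho> g = mat n n (\<lambda>(i, j). if e i = g \<otimes> e j then 1 else (0::complex))" for g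
  have \<rho>c: "\<rho> g \<in> carrier_mat n n" for g by (simp add: \<rho>_def)
  have apply_rho: "(\<rho> g *\<^sub>v v) $ i = v $ idx (inv g \<otimes> e i)"
    if g: "g \<in> carrier G" and v: "v \<in> carrier_vec n" and i: "i < n" for g v i
  proof -
    have "(\<rho> g *\<^sub>v v) $ i = (\<Sum>j\<in>{0..<n}. (if e i = g \<otimes> e j then 1 else 0) * v $ j)"
      using v i by (simp add: \<rho>_def scalar_prod_def)
    also have "\<dots> = (\<Sum>j\<in>{0..<n}. if j = idx (inv g \<otimes> e i) then v $ j else 0)"
    proof (rule sum.cong[OF refl])
      fix j assume j: "j \<in> {0..<n}"
      then have "e i = g \<otimes> e j \<longleftrightarrow> inv g \<otimes> e i = e j"
        using g i ec by (metis atLeastLessThan_iff inv_solve_left m_closed inv_closed)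
      also have "\<dots> \<longleftrightarrow> j = idx (inv g \<otimes> e i)"
        using j g i ec by (intro e_iff) auto
      finally show "(if e i = g \<otimes> e j then 1 else 0) * v $ j = (if j = idx (inv g \<otimes> e i) then v $ j else 0)"
        by simp
    qed
    also have "\<dots> = v $ idx (inv g \<otimes> e i)"
      using idx(1)[of "inv g \<otimes> e i"] g ec[OF i] by simp
    finally show ?thesis .
  qed
  have rep: "matrix_rep G n \<rho>"
    unfolding matrix_rep_def
  proof (intro conjI ballI)
    show "\<rho> \<in> carrier G \<rightarrow> carrier_mat n n" using \<rho>c by blast
    have "i = j" if "i < n" "j < n" "e i = e j" for i j
      using e that by (auto simp: bij_betw_def inj_on_def)
    then show "\<rho> \<one> = 1\<^sub>m n"
      using ec by (intro eq_matI) (auto simp: \<rho>_def)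
    fix g h assume g: "g \<in> carrier G" and h: "h \<in> carrier G"
    show "\<rho> (g \<otimes> h) = \<rho> g * \<rho> h"
    proof (rule mat_eqI_mult_vec)
      fix v :: "complex vec" assume v: "v \<in> carrier_vec n"
      have hv: "\<rho> h *\<^sub>v v \<in> carrier_vec n" using \<rho>c[of h] v by simp
      have "\<rho> (g \<otimes> h) *\<^sub>v v = \<rho> g *\<^sub>v (\<rho> h *\<^sub>v v)"
      proof (rule eq_vecI)
        fix i assume "i < dim_vec (\<rho> g *\<^sub>v (\<rho> h *\<^sub>v v))"
        then have i: "i < n" by (simp add: \<rho>_def)
        have gi: "inv g \<otimes> e i \<in> carrier G" using g ec[OF i] by simp
        have "(\<rho> (g \<otimes> h) *\<^sub>v v) $ i = v $ idx (inv (g \<otimes> h) \<otimes> e i)"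
          using g h v i by (intro apply_rho) auto
        also have "inv (g \<otimes> h) \<otimes> e i = inv h \<otimes> e (idx (inv g \<otimes> e i))"
          using g h ec[OF i] idx(2)[OF gi] by (simp add: inv_mult_group m_assoc)
        also have "v $ idx (inv h \<otimes> e (idx (inv g \<otimes> e i))) = (\<rho> h *\<^sub>v v) $ idx (inv g \<otimes> e i)"
          using apply_rho[OF h v idx(1)[OF gi]] by simp
        also have "\<dots> = (\<rho> g *\<^sub>v (\<rho> h *\<^sub>v v)) $ i"
          using apply_rho[OF g hv i] by simp
        finally show "(\<rho> (g \<otimes> h) *\<^sub>v v) $ i = (\<rho> g *\<^sub>v (\<rho> h *\<^sub>v v)) $ i" .
      qed (simp add: \<rho>_def)
      also have "\<dots> = (\<rho> g * \<rho> h) *\<^sub>v v"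
        using assoc_mult_mat_vec[OF \<rho>c \<rho>c v] by simp
      finally show "\<rho> (g \<otimes> h) *\<^sub>v v = (\<rho> g * \<rho> h) *\<^sub>v v" .
    qed (use \<rho>c[of g] \<rho>c[of h] \<rho>c[of "g \<otimes> h"] in auto)
  qed
  \<comment> \<open>The eigenvector is the character \<open>z\<^sup>k \<mapsto> w (- k)\<close> of the cyclic group generated by \<open>z\<close>, extended by 0.\<close>
  define m where "m = ord z"
  have m: "m > 1"
    using ord_ge_1[OF fin z] ord_eq_1[OF z] z1 by (auto simp: m_def)
  \<comment> \<open>\<open>w 1\<close> is a primitive \<open>m\<close>-th root of unity and
    \<open>w k\<close> is its \<open>k\<close>-th power.\<close>
  define w where "w k = cis (2 * pi * real_of_int k / real m)" for k :: int
  have w_add: "w (k + l) = w k * w l" for k l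
    by (simp add: w_def cis_mult add_divide_distrib ring_distribs)
  have w_dvd: "w k = 1 \<longleftrightarrow> int m dvd k" for k
  proof -
    have "cis x = 1 \<longleftrightarrow> cos x = 1" for x
      using cos_one_sin_zero[of x] by (auto simp: complex_eq_iff)
    then have "w k = 1 \<longleftrightarrow> (\<exists>l::int. 2 * pi * real_of_int k / real m = of_int l * 2 * pi)"
      unfolding w_def cos_one_2pi_int[symmetric] by blast
    also have "\<dots> \<longleftrightarrow> (\<exists>l. real_of_int k = of_int (int m * l))"
    proof -
      have "2 * pi * real_of_int k / real m = of_int l * 2 * pi \<longleftrightarrow> real_of_int k = of_int (int m * l)" for l
        using m by (simp add: field_simps)
      then show ?thesis by blast
    qed
    also have "\<dots> \<longleftrightarrow> int m dvd k" unfolding of_int_eq_iff by (auto simp: dvd_def)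
    finally show ?thesis .
  qed
  \<comment> \<open>Equal powers of \<open>z\<close> have exponents congruent modulo its order
    \<open>m\<close>, so \<open>w\<close> of the exponent depends only on the power.\<close>
  have w_eq: "w k = w l" if "z [^] k = z [^] l" for k l
  proof -
    have "int m dvd (k - l)" using that int_pow_eq[OF z, of l k] by (simp add: m_def)
    then have "w (k - l) = 1" using w_dvd by blast
    then show ?thesis using w_add[of "k - l" l] by simp
  qed
  \<comment> \<open>The exponent picked by \<open>SOME\<close> is immaterial by \<open>w_eq\<close>.
    The minus sign makes the shift by \<open>inv z\<close> contribute the factor
    \<open>w 1\<close>.\<close>
  define f where "f g = (if \<exists>k::int. g = z [^] k then w (- (SOME k. g = z [^] k)) else 0)" for g
  have f_pow: "f (z [^] k) = w (- k)" for k
  proof -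
    have "z [^] k = z [^] (SOME l. z [^] k = z [^] (l::int))"
      by (rule someI[of _ k]) simp
    then have "z [^] (- k) = z [^] (- (SOME l. z [^] k = z [^] (l::int)))"
      using z by (metis int_pow_neg)
    from w_eq[OF this] show ?thesis by (auto simp: f_def)
  qed
  have f_shift: "f (inv z \<otimes> g) = w 1 * f g" if g: "g \<in> carrier G" for g
  proof (cases "\<exists>k::int. g = z [^] k")
    case True
    then obtain k :: int where k: "g = z [^] k" by blast
    have "inv z = z [^] (- 1 :: int)" using z int_pow_neg[OF z, of 1] by simp
    then have "inv z \<otimes> g = z [^] (- 1 + k)" using int_pow_mult[OF z, of "- 1" k] by (simp add: k)
    then have "f (inv z \<otimes> g) = w (1 + - k)" using f_pow[of "- 1 + k"] by simp
    then show ?thesis unfolding w_add by (simp add: f_pow k)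
  next
    case False
    \<comment> \<open>Multiplication by \<open>inv z\<close> does not lead into the cyclic subgroup
      from outside, so both sides of the shift relation are 0.\<close>
    have "inv z \<otimes> g \<noteq> z [^] k" for k :: int
    proof
      assume "inv z \<otimes> g = z [^] k"
      then have "g = z \<otimes> z [^] k" using z g by (metis inv_closed m_assoc r_inv l_one)
      then have "g = z [^] (1 + k)" using int_pow_mult[OF z, of 1 k] z by simp
      with False show False by blast
    qed
    with False show ?thesis by (simp add: f_def)
  qed
  define v where "v = vec n (\<lambda>i. f (e i))"
  have v: "v \<in> carrier_vec n" by (simp add: v_def)
  have "f \<one> \<noteq> 0" using f_pow[of 0] by (simp add: w_def)
  then have "v $ idx \<one> \<noteq> 0\<^sub>v n $ idx \<one>" using idx[OF one_closed] by (simp add: v_def)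
  then have "v \<noteq> 0\<^sub>v n" by metis
  moreover have "\<rho> z *\<^sub>v v = w 1 \<cdot>\<^sub>v v"
  proof (rule eq_vecI)
    fix i assume "i < dim_vec (w 1 \<cdot>\<^sub>v v)"
    then have i: "i < n" by (simp add: v_def)
    have "inv z \<otimes> e i \<in> carrier G" using z ec[OF i] by simp
    then show "(\<rho> z *\<^sub>v v) $ i = (w 1 \<cdot>\<^sub>v v) $ i"
      using apply_rho[OF z v i] idx f_shift[OF ec[OF i]] i by (simp add: v_def)
  qed (simp add: \<rho>_def v_def)
  moreover have "w 1 \<noteq> 1" using w_dvd[of 1] m by simp
  ultimately show ?thesis using that rep v by blast
qed

section \<open>Nonlinear irreducible representations and Schur's lemma\<close>

lemma (in group) nonlinear_irreducible_exists:
  assumes fin: "finite (carrier G)" and a: "a \<in> carrier G" and b: "b \<in> carrier G"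
    and ab: "a \<otimes> b \<noteq> b \<otimes> a" and central: "a \<otimes> b \<otimes> inv (b \<otimes> a) \<in> center G"
  obtains n \<sigma> where "irreducible_representation G n \<sigma>" "n > 1"
proof -
  define z where "z = a \<otimes> b \<otimes> inv (b \<otimes> a)"
  have z: "z \<in> carrier G" using a b by (simp add: z_def)
  \<comment> \<open>This form of the commutator relation serves twice: it gives
    \<open>z \<noteq> \<one>\<close>, and it makes \<open>z\<close> act trivially in degree
    1.\<close>
  have zba: "z \<otimes> (b \<otimes> a) = a \<otimes> b" using a b by (simp add: z_def m_assoc)
  then have "z \<noteq> \<one>" using ab a b by auto
  from regular_eigenvector[OF fin z this] obtain m \<rho> \<mu> v where
    \<rho>: "matrix_rep G m \<rho>" and \<mu>: "\<mu> \<noteq> 1" and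
    v: "v \<in> carrier_vec m" "v \<noteq> 0\<^sub>v m" "\<rho> z *\<^sub>v v = \<mu> \<cdot>\<^sub>v v" .
  define W where "W = {v \<in> carrier_vec m. \<rho> z *\<^sub>v v = \<mu> \<cdot>\<^sub>v v}"
  have inv: "invariant_subspace G m \<rho> W"
    unfolding W_def using eigenspace_invariant[OF \<rho>] central by (simp add: z_def)
  have "W \<noteq> {0\<^sub>v m}" using v by (auto simp: W_def)
  from matrix_rep_restrict_scalar[OF \<rho> is_group inv this z, of \<mu>]
  obtain d \<tau> where "0 < d" "matrix_rep G d \<tau>" "\<tau> z = \<mu> \<cdot>\<^sub>m 1\<^sub>m d"
    unfolding W_def by blast
  from irreducible_with_scalar[OF is_group z this(2,1,3)]
  obtain n \<sigma> where irr: "irreducible_representation G n \<sigma>" and \<sigma>z: "\<sigma> z = \<mu> \<cdot>\<^sub>m 1\<^sub>m n" .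
  have n: "n > 0" and \<sigma>: "matrix_rep G n \<sigma>"
    using irr by (simp_all add: irreducible_representation_def hom_GL_iff)
  have "n \<noteq> 1"
  proof
    assume n1: "n = 1"
    \<comment> \<open>In degree 1 the single matrix entry is a multiplicative complex function, so
      it agrees on \<open>a \<otimes> b\<close> and \<open>b \<otimes> a\<close>. This forces
      \<open>t z = 1\<close>, against \<open>\<mu> \<noteq> 1\<close>.\<close>
    define t where "t g = \<sigma> g $$ (0, 0)" for g
    have t_mult: "t (g \<otimes> h) = t g * t h" if "g \<in> carrier G" "h \<in> carrier G" for g h
      using matrix_repD(1)[OF \<sigma> that(1)] matrix_repD(1)[OF \<sigma> that(2)] matrix_repD(3)[OF \<sigma> that] n1
      by (simp add: t_def scalar_prod_def)
    have t1: "t \<one> = 1" using matrix_repD(2)[OF \<sigma>] n1 by (simp add: t_def)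
    have "t (b \<otimes> a) * t (inv (b \<otimes> a)) = 1"
      using t_mult[of "b \<otimes> a" "inv (b \<otimes> a)"] a b t1 by simp
    then have "t (b \<otimes> a) \<noteq> 0" by auto
    moreover have "t z * t (b \<otimes> a) = t (b \<otimes> a)"
      using t_mult[of z "b \<otimes> a"] t_mult[OF a b] t_mult[OF b a] zba z a b by (simp add: mult.commute)
    ultimately have "t z = 1" by simp
    then show False using \<sigma>z \<mu> n1 by (simp add: t_def)
  qed
  with that irr n show ?thesis by force
qed

text \<open>Schur's lemma: over the complex numbers \<open>\<rho> y\<close> has an eigenvalue, its
  eigenspace is invariant and nonzero, hence everything. So \<open>\<rho> y\<close> is a scalar
  matrix, with nonzero scalar by invertibility, and its trace is \<open>n\<close> times that
  scalar.\<close>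

lemma (in group) irreducible_center_trace_nonzero:
  assumes irr: "irreducible_representation G n \<rho>" and y: "y \<in> center G"
  shows "mat_trace (\<rho> y) \<noteq> 0"
proof -
  have n: "n > 0" and \<rho>: "matrix_rep G n \<rho>"
    using irr by (simp_all add: irreducible_representation_def hom_GL_iff)
  have yc: "y \<in> carrier G" using y by (simp add: center_def)
  note \<rho>y = matrix_repD(1)[OF \<rho> yc]
  obtain \<mu> where "eigenvalue (\<rho> y) \<mu>"
    using spectrum_non_empty[OF \<rho>y n] by (auto simp: spectrum_def)
  then obtain v where v: "v \<in> carrier_vec n" "v \<noteq> 0\<^sub>v n" "\<rho> y *\<^sub>v v = \<mu> \<cdot>\<^sub>v v"
    using \<rho>y by (auto simp: eigenvalue_def eigenvector_def)
  have "{v \<in> carrier_vec n. \<rho> y *\<^sub>v v = \<mu> \<cdot>\<^sub>v v} \<noteq> {0\<^sub>v n}" using v by blast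
  then have "{v \<in> carrier_vec n. \<rho> y *\<^sub>v v = \<mu> \<cdot>\<^sub>v v} = carrier_vec n"
    using irr eigenspace_invariant[OF \<rho> y, of \<mu>] unfolding irreducible_representation_def by blast
  then have scalar: "\<rho> y = \<mu> \<cdot>\<^sub>m 1\<^sub>m n" by (rule eigenspace_full[OF \<rho>y])
  have "\<rho> y * \<rho> (inv y) = 1\<^sub>m n"
    using matrix_repD(3)[OF \<rho> yc inv_closed[OF yc]] matrix_repD(2)[OF \<rho>] yc by simp
  \<comment> \<open>One entry of the identity suffices: it would be 0 if the scalar
    \<open>\<mu>\<close> were 0.\<close>
  then have "(\<rho> y * \<rho> (inv y)) $$ (0, 0) = 1" using n by simp
  then have "\<mu> \<noteq> 0"
    using n matrix_repD(1)[OF \<rho> inv_closed[OF yc]] by (auto simp: scalar scalar_prod_def)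
  then show ?thesis using n by (simp add: mat_trace_def scalar)
qed

section \<open>Pullback along a surjection and membership in the vanishing-off subgroup\<close>

text \<open>By surjectivity the operators \<open>\<rho> (\<pi> g)\<close> are exactly the operators
  \<open>\<rho> h\<close>, so both representations have the same invariant subspaces.\<close>

lemma irreducible_representation_pullback:
  assumes "group_hom G H \<pi>" and surj: "\<pi> ` carrier G = carrier H"
    and irr: "irreducible_representation H n \<rho>"
  shows "irreducible_representation G n (\<rho> \<circ> \<pi>)"
proof -
  interpret group_hom G H \<pi> by fact
  have "\<rho> \<circ> \<pi> \<in> hom G (GL n)"

    by (rule Group.hom_compose[OF homh]) (use irr in \<open>simp add: irreducible_representation_def\<close>)
  moreover have "invariant_subspace G n (\<rho> \<circ> \<pi>) W \<longleftrightarrow> invariant_subspace H n \<rho> W" for W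
    unfolding invariant_subspace_def surj[symmetric] by auto
  ultimately show ?thesis using irr by (simp add: irreducible_representation_def)
qed

text \<open>The character takes the value \<open>n\<close> at the identity, so it lies in
  \<open>nl G\<close> and witnesses that \<open>x\<close> is one of the generators.\<close>

lemma (in group) irreducible_trace_in_vanishing_off:
  assumes irr: "irreducible_representation G n \<rho>" and n: "n > 1"
    and x: "x \<in> carrier G" and tr: "mat_trace (\<rho> x) \<noteq> 0"
  shows "x \<in> vanishing_off G"
proof -
  have "matrix_rep G n \<rho>"
    using irr by (simp add: irreducible_representation_def hom_GL_iff)
  then have "mat_trace (\<rho> \<one>) = of_nat n" by (simp add: matrix_repD(2) mat_trace_def)
  then have "(\<lambda>g\<in>carrier G. mat_trace (\<rho> g)) \<in> nl G"
    using irr n by (auto simp: nl_def Irr_def)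
  with x tr have "x \<in> {g \<in> carrier G. \<exists>\<chi>\<in>nl G. \<chi> g \<noteq> 0}"
    by (auto intro!: bexI[of _ "\<lambda>g\<in>carrier G. mat_trace (\<rho> g)"])
  then show ?thesis unfolding vanishing_off_def by (rule generate.incl)
qed

section \<open>The upper central series and the conclusion\<close>

lemma (in group) comm_groupI_center:
  assumes "center G = carrier G"
  shows "comm_group G"
  using assms by (intro group_comm_groupI) (auto simp: center_def)

text \<open>Two elements commute modulo a normal subgroup exactly when their commutator lies in it;
  this removes the quotient from the successor step.\<close>

lemma (in group) mem_upper_central_Suc:
  "x \<in> upper_central G (Suc i) \<longleftrightarrow>
     x \<in> carrier G \<and> (\<forall>y\<in>carrier G. x \<otimes> y \<otimes> inv (y \<otimes> x) \<in> upper_central G i)"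
proof -
  interpret N: normal "upper_central G i" G by (rule upper_central_normal)
  have eq: "upper_central G i #> a = upper_central G i #> b \<longleftrightarrow> a \<otimes> inv b \<in> upper_central G i"
    if a: "a \<in> carrier G" and b: "b \<in> carrier G" for a b
  proof -
    have "upper_central G i #> a = upper_central G i #> b \<longleftrightarrow> a \<in> upper_central G i #> b"
      using rcos_self[OF a N.is_subgroup] repr_independence[OF _ b N.is_subgroup] by blast
    then show ?thesis using N.rcos_module[OF is_group b a] by simp
  qed
  have "upper_central G i #> x \<in> center (G Mod upper_central G i) \<longleftrightarrow>
      (\<forall>y\<in>carrier G. upper_central G i #> (x \<otimes> y) = upper_central G i #> (y \<otimes> x))"
    if "x \<in> carrier G"
    using that by (auto simp: center_def FactGroup_def RCOSETS_def N.rcos_sum)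
  then show ?thesis using eq by auto
qed

lemma (in group) upper_central_subset_vanishing_off:
  assumes fin: "finite (carrier G)" and nonabelian: "\<not> comm_group G" and nil: "nilpotent_group G"
    and c_def: "c = nilpotence_class G"
  shows "upper_central G (c - 1) \<subseteq> vanishing_off G"
proof
  have full: "upper_central G c = carrier G"
    using nil LeastI_ex[of "\<lambda>i. upper_central G i = carrier G"]
    unfolding c_def nilpotence_class_def nilpotent_group_def by blast
  have minimal: "upper_central G i \<noteq> carrier G" if "i < c" for i
    using not_less_Least[OF that[unfolded c_def nilpotence_class_def]] .
  have "center G \<noteq> carrier G" using nonabelian comm_groupI_center by blast
  then have "c \<noteq> 1" using full upper_central_1 by metis
  moreover have "c \<noteq> 0"
  proof
    assume "c = 0"
    then have "carrier G = {\<one>}" using full by simp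
    then have "center G = carrier G" by (auto simp: center_def)
    with \<open>center G \<noteq> carrier G\<close> show False ..
  qed
  \<comment> \<open>A nonabelian group has class at least 2, so \<open>k\<close> is
    \<open>c - 2\<close> and the subtraction in \<open>c - 1\<close> is not truncated.\<close>
  ultimately obtain k where c: "c = Suc (Suc k)" by (metis One_nat_def not0_implies_Suc)
  define N where "N = upper_central G k"
  define H where "H = G Mod N"
  interpret N: normal N G unfolding N_def by (rule upper_central_normal)
  interpret H: group H unfolding H_def by (rule N.factorgroup_is_group)
  interpret \<pi>: group_hom G H "\<lambda>x. N #> x"
    by unfold_locales (use N.r_coset_hom_Mod in \<open>simp add: H_def\<close>)
  have surj: "(\<lambda>x. N #> x) ` carrier G = carrier H" by (auto simp: H_def FactGroup_def RCOSETS_def)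
  have mem: "x \<in> upper_central G (Suc k) \<longleftrightarrow> x \<in> carrier G \<and> N #> x \<in> center H" for x
    by (simp add: N_def H_def)
  \<comment> \<open>\<open>Suc k\<close> lies below the class, so the series has not yet reached the
    whole group; such an \<open>a\<close> is not central modulo \<open>N\<close>.\<close>
  obtain a where a: "a \<in> carrier G" "a \<notin> upper_central G (Suc k)"
    using minimal[of "Suc k"] mem by (auto simp: c)
  then have "N #> a \<notin> center H" using mem by blast
  then obtain b where b: "b \<in> carrier G"
    and ab: "(N #> a) \<otimes>\<^bsub>H\<^esub> (N #> b) \<noteq> (N #> b) \<otimes>\<^bsub>H\<^esub> (N #> a)"
    using a(1) unfolding center_def surj[symmetric] by blast
  \<comment> \<open>The next term of the series is all of \<open>G\<close>, so every commutator
    falls into this one and becomes central in \<open>H\<close>.\<close>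
  have "a \<otimes> b \<otimes> inv (b \<otimes> a) \<in> upper_central G (Suc k)"
    using a b full mem_upper_central_Suc[of a "Suc k"] by (simp add: c)
  then have "N #> (a \<otimes> b \<otimes> inv (b \<otimes> a)) \<in> center H" using mem by blast
  then have "(N #> a) \<otimes>\<^bsub>H\<^esub> (N #> b) \<otimes>\<^bsub>H\<^esub> inv\<^bsub>H\<^esub> ((N #> b) \<otimes>\<^bsub>H\<^esub> (N #> a)) \<in> center H"
    using a b by simp
  moreover have "finite (carrier H)" using fin surj by (metis finite_imageI)
  ultimately obtain n \<sigma> where irr: "irreducible_representation H n \<sigma>" and n: "n > 1"
    using H.nonlinear_irreducible_exists[of "N #> a" "N #> b"] a b ab by (metis \<pi>.hom_closed)
  fix x assume "x \<in> upper_central G (c - 1)"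
  then have x: "x \<in> carrier G" "N #> x \<in> center H" using mem by (simp_all add: c)
  show "x \<in> vanishing_off G"
    \<comment> \<open>The pullback to \<open>G\<close> keeps the degree \<open>n\<close>, and its
      trace at \<open>x\<close> is that of \<open>\<sigma>\<close> at the central element
      \<open>N #> x\<close>.\<close>
    using irreducible_representation_pullback[OF \<pi>.group_hom_axioms surj irr] n x(1)
  proof (rule irreducible_trace_in_vanishing_off)
    show "mat_trace ((\<sigma> \<circ> (\<lambda>x. N #> x)) x) \<noteq> 0"
      using H.irreducible_center_trace_nonzero[OF irr x(2)] by simp
  qed
qed

theorem corollary3p8:
  fixes G :: "('a, 'b) monoid_scheme" and c :: nat
  assumes "group G"
    and "finite (carrier G)"
    and "\<not> comm_group G"
    and "nilpotent_group G"
    and "c = nilpotence_class G"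
  shows "upper_central G (c - 1) \<subseteq> vanishing_off G"
  using assms by (rule group.upper_central_subset_vanishing_off)

end
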